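(* Let $k\ge 2$ be a fixed integer. The quantity $n-\alpha_{k-1}(G)$ can be $k$-approximated in polynomial time on simple graphs: there is a polynomial-time algorithm which, given a simple graph $G$ on $n$ vertices, outputs a number $A(G)$ with $$n-\alpha_{k-1}(G)\ \le\ A(G)\ \le\ k\,\bigl(n-\alpha_{k-1}(G)\bigr).$$
   Context: Graphs are finite and connected. For a positive integer $m$, the $m$-component independence number $\alpha_m(G)$ is the maximum cardinality of a set $S\subseteq V(G)$ such that every connected component of the induced subgraph $G[S]$ has at most $m$ vertices. Here $n-\alpha_{k-1}(G)$ is regarded as a minimization objective (the minimum number of vertices whose deletion leaves only components with at most $k-1$ vertices). *)

theory Defs
  imports "Graph_Theory.Digraph_Component" "HOL-Computational_Algebra.Polynomial"
begin

section \<open>Component independence numbers\<close>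

text \<open>
  Undirected graphs are represented as symmetric digraphs; for these, the strongly connected
  components (\<^const>\<open>pre_digraph.sccs\<close>) are the connected components.
\<close>

definition component_independent :: "('a, 'b) pre_digraph \<Rightarrow> nat \<Rightarrow> 'a set \<Rightarrow> bool" where
  "component_independent G m S \<longleftrightarrow>
     S \<subseteq> verts G \<and> (\<forall>C \<in> pre_digraph.sccs (G \<restriction> S). card (verts C) \<le> m)"

definition component_independence_number :: "nat \<Rightarrow> ('a, 'b) pre_digraph \<Rightarrow> nat" where
  "component_independence_number m G = Max {card S | S. component_independent G m S}"

lemma component_independent_empty: "component_independent G m {}"
  by (auto simp: component_independent_def pre_digraph.sccs_def induced_subgraph_def
      subgraph_def strongly_connected_def)

text \<open>The maximum ranges over a finite nonempty set, and \<open>n - \<alpha>\<^sub>m(G)\<close> is not truncated in \<^typ>\<open>nat\<close>.\<close>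

lemma
  assumes "finite (verts G)"
  shows finite_component_independent_cards: "finite {card S | S. component_independent G m S}"
    and component_independent_cards_nonempty: "{card S | S. component_independent G m S} \<noteq> {}"
    and component_independence_number_le: "component_independence_number m G \<le> card (verts G)"
proof -
  let ?M = "{card S | S. component_independent G m S}"
  have le: "\<And>x. x \<in> ?M \<Longrightarrow> x \<le> card (verts G)"
    using assms by (auto simp: component_independent_def intro: card_mono)
  then show fin: "finite ?M"
    by (meson finite_nat_set_iff_bounded_le)
  show ne: "?M \<noteq> {}"
    using component_independent_empty by blast
  show "component_independence_number m G \<le> card (verts G)"
    unfolding component_independence_number_def using fin ne le by (simp add: Max_le_iff)
qed


section \<open>Polynomial time\<close>

text \<open>
  Machine model: the random access machine of Cook and Reckhow (1973), over the natural numbers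
  and with a read-only input tape of bits. Every instruction costs one unit. As there is no
  multiplication or shift, \<open>t\<close> steps of a fixed program only produce numbers with \<open>O(t)\<close> bits, so
  polynomial time on this machine coincides with polynomial time on Turing machines.
\<close>

datatype instr =
    Const nat nat    \<comment> \<open>\<open>X\<^sub>i \<leftarrow> c\<close>\<close>
  | Add nat nat nat  \<comment> \<open>\<open>X\<^sub>i \<leftarrow> X\<^sub>j + X\<^sub>l\<close>\<close>
  | Sub nat nat nat  \<comment> \<open>\<open>X\<^sub>i \<leftarrow> X\<^sub>j - X\<^sub>l\<close>, truncated at 0\<close>
  | Load nat nat     \<comment> \<open>\<open>X\<^sub>i \<leftarrow> X[X\<^sub>j]\<close>\<close>
  | Store nat nat    \<comment> \<open>\<open>X[X\<^sub>i] \<leftarrow> X\<^sub>j\<close>\<close>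
  | Jump nat nat     \<comment> \<open>go to instruction \<open>a\<close> if \<open>X\<^sub>i > 0\<close>\<close>
  | Read nat         \<comment> \<open>\<open>X\<^sub>i \<leftarrow>\<close> next input bit, or 2 at the end of the input\<close>

text \<open>Program counter, memory, and unread part of the input.\<close>

type_synonym config = "nat \<times> (nat \<Rightarrow> nat) \<times> bool list"

fun exec :: "instr \<Rightarrow> config \<Rightarrow> config" where
  "exec (Const i c) (pc, X, w) = (Suc pc, X(i := c), w)"
| "exec (Add i j l) (pc, X, w) = (Suc pc, X(i := X j + X l), w)"
| "exec (Sub i j l) (pc, X, w) = (Suc pc, X(i := X j - X l), w)"
| "exec (Load i j) (pc, X, w) = (Suc pc, X(i := X (X j)), w)"
| "exec (Store i j) (pc, X, w) = (Suc pc, X(X i := X j), w)"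
| "exec (Jump i a) (pc, X, w) = (if X i > 0 then a else Suc pc, X, w)"
| "exec (Read i) (pc, X, []) = (Suc pc, X(i := 2), [])"
| "exec (Read i) (pc, X, b # w) = (Suc pc, X(i := of_bool b), w)"

text \<open>The machine halts when the program counter leaves the program; the output is then \<open>X\<^sub>0\<close>.
  As \<open>step\<close> fixes halted configurations, \<open>outputs_within p w t r\<close> holds whenever \<open>p\<close> halts on \<open>w\<close>
  after at most \<open>t\<close> steps with output \<open>r\<close>.\<close>

definition step :: "instr list \<Rightarrow> config \<Rightarrow> config" where
  "step p s = (if fst s < length p then exec (p ! fst s) s else s)"

definition run :: "instr list \<Rightarrow> bool list \<Rightarrow> nat \<Rightarrow> config" where
  "run p w t = (step p ^^ t) (0, (\<lambda>_. 0), w)"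

definition outputs_within :: "instr list \<Rightarrow> bool list \<Rightarrow> nat \<Rightarrow> nat \<Rightarrow> bool" where
  "outputs_within p w t r \<longleftrightarrow>
     (case run p w t of (pc, X, _) \<Rightarrow> pc \<ge> length p \<and> X 0 = r)"

definition polytime_computable :: "'a set \<Rightarrow> ('a \<Rightarrow> bool list) \<Rightarrow> ('a \<Rightarrow> nat) \<Rightarrow> bool" where
  "polytime_computable D enc f \<longleftrightarrow>
     (\<exists>(p :: instr list) (q :: nat poly). \<forall>x \<in> D.
        outputs_within p (enc x) (poly q (length (enc x))) (f x))"


section \<open>Input graphs\<close>

text \<open>
  Finite connected simple graphs with vertices labelled \<open>0, \<dots>, n - 1\<close>, given to the machine as
  the word \<open>1\<^sup>n 0\<close> followed by the \<open>n \<times> n\<close> adjacency matrix in row-major order.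
\<close>

definition connected_simple_graphs :: "nat pair_pre_digraph set" where
  "connected_simple_graphs =
     {G. pair_graph G \<and> Digraph_Component.connected (with_proj G) \<and> (\<exists>n. pverts G = {0..<n})}"

definition encode_graph :: "nat pair_pre_digraph \<Rightarrow> bool list" where
  "encode_graph G =
     (let n = card (pverts G)
      in replicate n True @ [False] @ [(i, j) \<in> parcs G. i \<leftarrow> [0..<n], j \<leftarrow> [0..<n]])"

end

theory Submission
  imports Defs
begin

text \<open>
  Vertices are processed in order. From each vertex that is still unassigned, a connected block of
  unassigned vertices is grown until it has \<open>k\<close> vertices or no unassigned neighbour is left.
  The algorithm outputs the total size of the blocks with exactly \<open>k\<close> vertices. Deleting these
  blocks leaves the smaller ones, between which there is no edge, so the output is at least
  \<open>n - \<alpha>\<^bsub>k-1\<^esub>(G)\<close>. Conversely, each of the deleted blocks is connected with \<open>k\<close> vertices and thus contains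
  a vertex of every feasible deletion set; as the blocks are disjoint, such a set has at least as many vertices as
  there are such blocks.
\<close>

section \<open>Structured programs for the random access machine\<close>

text \<open>A block that stops with fewer than \<open>k\<close> vertices may be adjacent to earlier
  blocks, but all its neighbours are assigned when it stops, so none of them ends up in a later
  block. Applied to both ends of an edge between two small blocks, this makes the blocks coincide.
  The cap at \<open>k\<close> yields the ratio: a deleted block costs exactly \<open>k\<close> and
  certifies one unavoidable deletion. Polynomial time refers to a concrete machine program, so the
  algorithm occurs twice: as the function \<open>greedy\<close> on labellings, whose graph-theoretic
  invariants never mention memory, and as the program \<open>greedy_com k\<close>, shown to compute
  the same value by Hoare triples that carry a step bound. Apart from reading the input, every loop
  has a number of rounds fixed by \<open>n\<close> and \<open>k\<close>, so the bound depends on the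
  graph only through \<open>n\<close>. Scanning pairs in the order of the input matrix replaces
  address arithmetic, which would need multiplication, by one advancing pointer.\<close>

fun jump_free :: "instr \<Rightarrow> bool" where
  "jump_free (Jump _ _) = False"
| "jump_free _ = True"

text \<open>The counter 0 is a dummy: how an instruction acts on memory and input does not depend on
  the program counter.\<close>

definition effect :: "instr \<Rightarrow> (nat \<Rightarrow> nat) \<times> bool list \<Rightarrow> (nat \<Rightarrow> nat) \<times> bool list" where
  "effect c s = snd (exec c (0, s))"

lemma effect_simps [simp]:
  "effect (Const i c) (X, w) = (X(i := c), w)"
  "effect (Add i j l) (X, w) = (X(i := X j + X l), w)"
  "effect (Sub i j l) (X, w) = (X(i := X j - X l), w)"
  "effect (Load i j) (X, w) = (X(i := X (X j)), w)"
  "effect (Store i j) (X, w) = (X(X i := X j), w)"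
  "effect (Read i) (X, []) = (X(i := 2), [])"
  "effect (Read i) (X, b # w) = (X(i := of_bool b), w)"
  by (simp_all add: effect_def)

lemma exec_jump_free: "jump_free c \<Longrightarrow> exec c (pc, s) = (Suc pc, effect c s)"
  by (cases s; cases c; cases "snd s") auto

text \<open>The machine branches only on a positive register. \<open>Unless\<close> and
  \<open>Do_While\<close> are the two control structures that cost a single such jump, forward over
  a body or backward to its start.\<close>

datatype com =
    Block "instr list"
  | Seq com com (infixr \<open>;;\<close> 60)
  | Unless nat com
  | Do_While com nat

text \<open>Jump targets are absolute, so compilation needs the address \<open>a\<close> at which
  the fragment will be placed.\<close>

fun code :: "nat \<Rightarrow> com \<Rightarrow> instr list" where
  "code a (Block cs) = cs"
| "code a (c ;; d) = code a c @ code (a + length (code a c)) d"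
| "code a (Unless i c) = Jump i (Suc a + length (code (Suc a) c)) # code (Suc a) c"
| "code a (Do_While c i) = code a c @ [Jump i a]"

text \<open>Total correctness within \<open>t\<close> steps. The quantification over the surrounding
  code \<open>l\<close> and \<open>r\<close> makes triples composable: a neighbouring fragment is
  simply absorbed into the context.\<close>

definition triple ::
  "((nat \<Rightarrow> nat) \<Rightarrow> bool list \<Rightarrow> bool) \<Rightarrow> com \<Rightarrow> nat \<Rightarrow> ((nat \<Rightarrow> nat) \<Rightarrow> bool list \<Rightarrow> bool) \<Rightarrow> bool" where
  "triple P c t Q \<longleftrightarrow>
     (\<forall>l r X w. P X w \<longrightarrow>
        (\<exists>t' X' w'. t' \<le> t \<and>
           (step (l @ code (length l) c @ r) ^^ t') (length l, X, w) =
             (length l + length (code (length l) c), X', w') \<and> Q X' w'))"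

lemma triple_consequence:
  assumes "triple P c t Q" "\<And>X w. P' X w \<Longrightarrow> P X w" "\<And>X w. Q X w \<Longrightarrow> Q' X w" "t \<le> t'"
  shows "triple P' c t' Q'"
  using assms unfolding triple_def by (meson le_trans)

lemma step_append: "step (l @ c # r) (length l, s) = exec c (length l, s)"
  by (simp add: step_def)

lemma steps_jump_free:
  assumes "list_all jump_free cs"
  shows "(step (l @ cs @ r) ^^ length cs) (length l, s) = (length l + length cs, fold effect cs s)"
  using assms
proof (induction cs arbitrary: l s)
  case (Cons c cs)
  then have "(step ((l @ [c]) @ cs @ r) ^^ length cs) (length (l @ [c]), effect c s) =
      (length (l @ [c]) + length cs, fold effect cs (effect c s))"
    by (intro Cons.IH) simp
  then show ?case
    using Cons.prems by (simp add: step_append exec_jump_free funpow_swap1 del: funpow.simps(2) add: funpow_Suc_right)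
qed simp

lemma triple_Block:
  assumes "list_all jump_free cs"
    and "\<And>X w. P X w \<Longrightarrow> (case fold effect cs (X, w) of (X', w') \<Rightarrow> Q X' w')"
  shows "triple P (Block cs) (length cs) Q"
  unfolding triple_def
proof (intro allI impI)
  fix l r :: "instr list" and X w
  assume "P X w"
  then have "case fold effect cs (X, w) of (X', w') \<Rightarrow> Q X' w'"
    by (rule assms(2))
  moreover obtain X' w' where "fold effect cs (X, w) = (X', w')"
    by fastforce
  ultimately show "\<exists>t' X' w'. t' \<le> length cs \<and>
      (step (l @ code (length l) (Block cs) @ r) ^^ t') (length l, X, w) =
        (length l + length (code (length l) (Block cs)), X', w') \<and> Q X' w'"
    using steps_jump_free[OF assms(1), of l r "(X, w)"] by auto
qed

lemma triple_Seq:
  assumes c: "triple P c t R" and d: "triple R d u Q"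
  shows "triple P (c ;; d) (t + u) Q"
  unfolding triple_def
proof (intro allI impI)
  fix l r :: "instr list" and X w
  assume "P X w"
  let ?c = "code (length l) c"
  let ?d = "code (length (l @ ?c)) d"
  obtain t' X' w' where t': "t' \<le> t" "R X' w'"
      "(step (l @ ?c @ (?d @ r)) ^^ t') (length l, X, w) = (length l + length ?c, X', w')"
    using c \<open>P X w\<close> unfolding triple_def by blast
  obtain u' X'' w'' where u': "u' \<le> u" "Q X'' w''"
      "(step ((l @ ?c) @ ?d @ r) ^^ u') (length (l @ ?c), X', w') =
         (length (l @ ?c) + length ?d, X'', w'')"
    using d \<open>R X' w'\<close> unfolding triple_def by blast
  have "(step (l @ (?c @ ?d) @ r) ^^ (u' + t')) (length l, X, w) =
      (length l + length (?c @ ?d), X'', w'')"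
    using t' u' by (simp add: funpow_add)
  then show "\<exists>t' X' w'. t' \<le> t + u \<and>
      (step (l @ code (length l) (c ;; d) @ r) ^^ t') (length l, X, w) =
        (length l + length (code (length l) (c ;; d)), X', w') \<and> Q X' w'"
    using t'(1) u'(1,2) by (intro exI[of _ "u' + t'"] exI) (auto simp: add.commute)
qed

lemma triple_Unless:
  assumes c: "triple (\<lambda>X w. P X w \<and> X i = 0) c t Q" and skip: "\<And>X w. P X w \<Longrightarrow> X i > 0 \<Longrightarrow> Q X w"
  shows "triple P (Unless i c) (Suc t) Q"
  unfolding triple_def
proof (intro allI impI)
  fix l r :: "instr list" and X w
  assume P: "P X w"
  let ?jump = "Jump i (Suc (length l) + length (code (Suc (length l)) c))"
  let ?c = "code (length (l @ [?jump])) c"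
  let ?p = "l @ code (length l) (Unless i c) @ r"
  have p: "?p = l @ ?jump # ?c @ r" by simp
  show "\<exists>t' X' w'. t' \<le> Suc t \<and>
      (step ?p ^^ t') (length l, X, w) = (length l + length (code (length l) (Unless i c)), X', w') \<and> Q X' w'"
  proof (cases "X i = 0")
    case True
    then obtain t' X' w' where t': "t' \<le> t" "Q X' w'"
        "(step ((l @ [?jump]) @ ?c @ r) ^^ t') (length (l @ [?jump]), X, w) =
           (length (l @ [?jump]) + length ?c, X', w')"
      using c P unfolding triple_def by blast
    have "(step ?p ^^ Suc t') (length l, X, w) = (length l + length (code (length l) (Unless i c)), X', w')"
      using t'(3) True unfolding p funpow_Suc_right o_apply step_append by simp
    then show ?thesis
      using t' by (intro exI[of _ "Suc t'"]) auto
  next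
    case False
    then have "(step ?p ^^ 1) (length l, X, w) = (length l + length (code (length l) (Unless i c)), X, w)"
      unfolding p by (simp add: step_append)
    then show ?thesis
      using skip[OF P] False by (intro exI[of _ 1] exI[of _ X] exI[of _ w]) auto
  qed
qed

text \<open>\<open>v\<close> counts completed rounds. A round either exits with \<open>Q\<close> or
  must establish \<open>Suc v < N\<close>, which gives termination; the induction is on the rounds
  left, each costing \<open>t\<close> plus one jump.\<close>

lemma triple_Do_While:
  assumes body: "\<And>v. v < N \<Longrightarrow>
      triple (I v) c t (\<lambda>X w. if X i = 0 then Q X w else Suc v < N \<and> I (Suc v) X w)"
    and "v < N"
  shows "triple (I v) (Do_While c i) ((N - v) * Suc t) Q"
  using \<open>v < N\<close>
proof (induction "N - v" arbitrary: v)
  case (Suc m)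
  show ?case
    unfolding triple_def
  proof (intro allI impI)
    fix l r :: "instr list" and X w
    assume I: "I v X w"
    let ?c = "code (length l) c"
    let ?p = "l @ code (length l) (Do_While c i) @ r"
    have p: "?p = l @ ?c @ Jump i (length l) # r" "?p = (l @ ?c) @ Jump i (length l) # r"
      by simp_all
    obtain t' X' w' where t': "t' \<le> t"
        and run: "(step ?p ^^ t') (length l, X, w) = (length l + length ?c, X', w')"
        and post: "if X' i = 0 then Q X' w' else Suc v < N \<and> I (Suc v) X' w'"
      using body[OF Suc.prems] I unfolding triple_def p(1) by blast
    have jump: "step ?p (length l + length ?c, X', w') =
        (if X' i = 0 then length l + length (code (length l) (Do_While c i)) else length l, X', w')"
      using step_append[of "l @ ?c" "Jump i (length l)" r "(X', w')"] unfolding p(2) by simp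
    show "\<exists>t' X' w'. t' \<le> (N - v) * Suc t \<and>
        (step ?p ^^ t') (length l, X, w) =
          (length l + length (code (length l) (Do_While c i)), X', w') \<and> Q X' w'"
    proof (cases "X' i = 0")
      case True
      then have "(step ?p ^^ Suc t') (length l, X, w) =
          (length l + length (code (length l) (Do_While c i)), X', w')"
        using run jump by simp
      moreover have "Suc t' \<le> (N - v) * Suc t"
        using t' Suc.prems by (metis Suc_le_mono diff_is_0_eq le_trans mult_le_mono1 nat_mult_1 not_less
            One_nat_def Suc_leI zero_less_diff)
      moreover have "Q X' w'"
        using post True by simp
      ultimately show ?thesis
        by blast
    next
      case False
      then have I': "Suc v < N" "I (Suc v) X' w'"
        using post by auto
      then have "triple (I (Suc v)) (Do_While c i) ((N - Suc v) * Suc t) Q"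
        using Suc.hyps(2) by (intro Suc.hyps(1)) auto
      then obtain u X'' w'' where u: "u \<le> (N - Suc v) * Suc t"
          "(step ?p ^^ u) (length l, X', w') =
             (length l + length (code (length l) (Do_While c i)), X'', w'')" "Q X'' w''"
        using I'(2) unfolding triple_def by blast
      have "(step ?p ^^ (u + Suc t')) (length l, X, w) =
          (length l + length (code (length l) (Do_While c i)), X'', w'')"
        using run jump False u(2) by (simp add: funpow_add del: add_Suc_right)
      moreover have "u + Suc t' \<le> (N - v) * Suc t"
      proof -
        have "N - v = Suc (N - Suc v)"
          using Suc.prems by simp
        then show ?thesis
          using t' u(1) by simp
      qed
      ultimately show ?thesis
        using u(3) by blast
    qed
  qed
qed simp

lemma step_halted: "fst s \<ge> length p \<Longrightarrow> (step p ^^ t) s = s"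
  by (induction t) (auto simp: step_def)

text \<open>With empty context the fragment ends exactly where the machine halts, and a halted
  configuration is fixed, so the remaining \<open>u - t'\<close> steps are idle.\<close>

lemma triple_outputs_within:
  assumes c: "triple P c t (\<lambda>X w. X 0 = r)" and "P (\<lambda>_. 0) w" "t \<le> u"
  shows "outputs_within (code 0 c) w u r"
proof -
  obtain t' X' w' where t': "t' \<le> t" "(step (code 0 c) ^^ t') (0, \<lambda>_. 0, w) = (length (code 0 c), X', w')"
      "X' 0 = r"
    using c[unfolded triple_def, rule_format, of "\<lambda>_. 0" w "[]" "[]"] assms(2) by auto
  have "u = (u - t') + t'"
    using t'(1) assms(3) by simp
  then have "run (code 0 c) w u = (step (code 0 c) ^^ (u - t')) ((step (code 0 c) ^^ t') (0, \<lambda>_. 0, w))"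
    unfolding run_def by (metis comp_apply funpow_add)
  then show ?thesis
    using t' by (simp add: outputs_within_def step_halted)
qed

section \<open>Greedy extraction of connected blocks\<close>

text \<open>A labelling \<open>L\<close> records the block of each vertex: \<open>Suc s\<close> for the block grown from \<open>s\<close>,
  and \<open>0\<close> if the vertex is still unassigned.\<close>

definition visit :: "nat rel \<Rightarrow> nat \<Rightarrow> nat \<Rightarrow> nat \<Rightarrow> nat \<Rightarrow> (nat \<Rightarrow> nat) \<times> nat \<Rightarrow> (nat \<Rightarrow> nat) \<times> nat" where
  "visit E k b i j = (\<lambda>(L, c). if (i, j) \<in> E \<and> L i = b \<and> L j = 0 \<and> c < k then (L(j := b), Suc c) else (L, c))"

text \<open>Row-major order, as in the encoded matrix. Updates are in place: a vertex added early
  can already recruit neighbours later in the same sweep.\<close>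

definition sweep :: "nat rel \<Rightarrow> nat \<Rightarrow> nat \<Rightarrow> nat \<Rightarrow> (nat \<Rightarrow> nat) \<times> nat \<Rightarrow> (nat \<Rightarrow> nat) \<times> nat" where
  "sweep E n k b = fold (\<lambda>i. fold (visit E k b i) [0..<n]) [0..<n]"

text \<open>If \<open>s\<close> is already assigned, no vertex carries the label
  \<open>Suc s\<close>, so the sweeps that follow do nothing and the count stays 0.\<close>

definition seed :: "nat \<Rightarrow> (nat \<Rightarrow> nat) \<Rightarrow> (nat \<Rightarrow> nat) \<times> nat" where
  "seed s L = (if L s = 0 then (L(s := Suc s), 1) else (L, 0))"

text \<open>Every sweep that is not already a fixed point adds a vertex, so \<open>k\<close> of them suffice.\<close>

definition grow :: "nat rel \<Rightarrow> nat \<Rightarrow> nat \<Rightarrow> nat \<Rightarrow> (nat \<Rightarrow> nat) \<Rightarrow> (nat \<Rightarrow> nat) \<times> nat" where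
  "grow E n k s L = (sweep E n k (Suc s) ^^ k) (seed s L)"

definition harvest :: "nat rel \<Rightarrow> nat \<Rightarrow> nat \<Rightarrow> nat \<Rightarrow> (nat \<Rightarrow> nat) \<times> nat \<Rightarrow> (nat \<Rightarrow> nat) \<times> nat" where
  "harvest E n k s = (\<lambda>(L, t). case grow E n k s L of (L', c) \<Rightarrow> (L', if c < k then t else t + c))"

definition greedy :: "nat rel \<Rightarrow> nat \<Rightarrow> nat \<Rightarrow> (nat \<Rightarrow> nat) \<times> nat" where
  "greedy E n k = fold (harvest E n k) [0..<n] (\<lambda>_. 0, 0)"

text \<open>True of the empty set, which is the block of a start vertex that was assigned
  earlier.\<close>

definition connected_from :: "'a rel \<Rightarrow> 'a \<Rightarrow> 'a set \<Rightarrow> bool" where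
  "connected_from E s T \<longleftrightarrow> (\<forall>v\<in>T. (s, v) \<in> (E \<inter> T \<times> T)\<^sup>*)"

lemma connected_from_root: "connected_from E s T \<Longrightarrow> v \<in> T \<Longrightarrow> s \<in> T"
  unfolding connected_from_def by (metis IntD2 SigmaD1 converse_rtranclE)

lemma connected_from_insert:
  assumes "connected_from E s T" "u \<in> T" "(u, v) \<in> E"
  shows "connected_from E s (insert v T)"
proof -
  let ?R = "E \<inter> insert v T \<times> insert v T"
  have "(E \<inter> T \<times> T)\<^sup>* \<subseteq> ?R\<^sup>*"
    by (rule rtrancl_mono) auto
  then have T: "(s, x) \<in> ?R\<^sup>*" if "x \<in> T" for x
    using assms(1) that by (auto simp: connected_from_def)
  moreover have "(u, v) \<in> ?R"
    using assms by auto
  ultimately have "(s, v) \<in> ?R\<^sup>*"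
    using assms(2) by (meson rtrancl.rtrancl_into_rtrancl)
  then show ?thesis
    using T by (auto simp: connected_from_def)
qed

section \<open>Stabilisation of iterated maps that increase a measure\<close>

definition progressive :: "('a \<Rightarrow> nat) \<Rightarrow> ('a \<Rightarrow> 'a) \<Rightarrow> bool" where
  "progressive m f \<longleftrightarrow> (\<forall>\<sigma>. m \<sigma> \<le> m (f \<sigma>) \<and> (m (f \<sigma>) = m \<sigma> \<longrightarrow> f \<sigma> = \<sigma>))"

lemma progressiveD:
  assumes "progressive m f"
  shows "m \<sigma> \<le> m (f \<sigma>)" "m (f \<sigma>) = m \<sigma> \<Longrightarrow> f \<sigma> = \<sigma>"
  using assms unfolding progressive_def by blast+

lemma progressive_fold:
  assumes "\<And>x. progressive m (f x)"
  shows "progressive m (fold f xs)"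
proof (induction xs)
  case (Cons x xs)
  show ?case
    unfolding progressive_def fold.simps o_apply
  proof (intro allI conjI impI)
    fix \<sigma>
    have le: "m \<sigma> \<le> m (f x \<sigma>)" "m (f x \<sigma>) \<le> m (fold f xs (f x \<sigma>))"
      by (rule progressiveD[OF assms] progressiveD[OF Cons.IH])+
    show "m \<sigma> \<le> m (fold f xs (f x \<sigma>))"
      using le by (rule le_trans)
    assume "m (fold f xs (f x \<sigma>)) = m \<sigma>"
    then have "m (f x \<sigma>) = m \<sigma>" "m (fold f xs (f x \<sigma>)) = m (f x \<sigma>)"
      using le by linarith+
    then show "fold f xs (f x \<sigma>) = \<sigma>"
      using progressiveD(2)[OF assms] progressiveD(2)[OF Cons.IH] by metis
  qed
qed (simp add: progressive_def)

text \<open>The measure is squeezed: it cannot drop along the fold and ends where it began, so every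
  factor left it, and hence the state, unchanged. This turns a fixed sweep into fixed single
  visits.\<close>

lemma progressive_fold_fixed:
  assumes "\<And>x. progressive m (f x)" "fold f xs \<sigma> = \<sigma>" "x \<in> set xs"
  shows "f x \<sigma> = \<sigma>"
  using assms(2,3)
proof (induction xs)
  case (Cons y ys)
  have "m (f y \<sigma>) \<le> m (fold f ys (f y \<sigma>))" "m \<sigma> \<le> m (f y \<sigma>)"
    by (rule progressiveD(1) progressive_fold assms(1))+
  then have "m (f y \<sigma>) = m \<sigma>"
    using Cons.prems(1) by simp
  then have fixed: "f y \<sigma> = \<sigma>"
    by (rule progressiveD(2)[OF assms(1)])
  then have "fold f ys \<sigma> = \<sigma>"
    using Cons.prems(1) by simp
  then show ?case
    using Cons.IH Cons.prems(2) fixed by (cases "x = y") simp_all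
qed simp

text \<open>Each application that is not yet at a fixed point raises the measure by at least 1. A
  bound on the measure therefore forces stabilisation.\<close>

lemma progressive_funpow:
  assumes "progressive m f"
  shows "f ((f ^^ r) \<sigma>) = (f ^^ r) \<sigma> \<or> m \<sigma> + r \<le> m ((f ^^ r) \<sigma>)"
proof (induction r)
  case (Suc r)
  let ?\<tau> = "(f ^^ r) \<sigma>"
  show ?case
  proof (cases "f ?\<tau> = ?\<tau>")
    case False
    then have "m ?\<tau> < m (f ?\<tau>)"
      using progressiveD[OF assms, of ?\<tau>] by linarith
    then show ?thesis
      using Suc False by simp
  qed simp
qed simp

lemma progressive_visit: "progressive snd (visit E k b i j)"
  by (auto simp: progressive_def visit_def)

lemma progressive_sweep: "progressive snd (sweep E n k b)"
  unfolding sweep_def by (intro progressive_fold progressive_visit)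

text \<open>If the guard of \<open>visit\<close> held at \<open>(i, j)\<close>, the count would
  rise. The other conjuncts are given, so \<open>L j = 0\<close> is the one that fails.\<close>

lemma sweep_fixed_closed:
  assumes "sweep E n k b (L, c) = (L, c)" "c < k" "(i, j) \<in> E" "i < n" "j < n" "L i = b"
  shows "L j \<noteq> 0"
proof -
  have "fold (visit E k b i) [0..<n] (L, c) = (L, c)"
  proof (rule progressive_fold_fixed[where f = "\<lambda>i. fold (visit E k b i) [0..<n]"])
    show "progressive snd (fold (visit E k b i) [0..<n])" for i
      by (intro progressive_fold progressive_visit)
    show "fold (\<lambda>i. fold (visit E k b i) [0..<n]) [0..<n] (L, c) = (L, c)"
      using assms(1) by (simp only: sweep_def)
    show "i \<in> set [0..<n]"
      using assms(4) by simp
  qed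
  then have "visit E k b i j (L, c) = (L, c)"
    by (rule progressive_fold_fixed[OF progressive_visit]) (use assms(5) in simp)
  then show ?thesis
    using assms by (auto simp: visit_def split: if_splits)
qed

section \<open>Growth of a single block\<close>

definition growth :: "nat rel \<Rightarrow> nat \<Rightarrow> nat \<Rightarrow> nat \<Rightarrow> (nat \<Rightarrow> nat) \<Rightarrow> (nat \<Rightarrow> nat) \<times> nat \<Rightarrow> bool" where
  "growth E n k s L\<^sub>0 = (\<lambda>(L, c).
     (\<forall>v. L v = L\<^sub>0 v \<or> L\<^sub>0 v = 0 \<and> L v = Suc s) \<and> (\<forall>v. L v \<noteq> 0 \<longrightarrow> v < n) \<and>
     c = card (L -` {Suc s}) \<and> c \<le> k \<and> connected_from E s (L -` {Suc s}))"

lemma finite_fiber: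
  fixes n :: nat
  assumes "\<And>v. L v \<noteq> 0 \<Longrightarrow> v < n"
  shows "finite (L -` {Suc b})"
proof (rule finite_subset)
  show "L -` {Suc b} \<subseteq> {..<n}"
    using assms by (metis lessThan_iff nat.distinct(1) subsetI vimage_singleton_eq)
qed simp

lemma growth_visit:
  assumes "growth E n k s L\<^sub>0 \<sigma>" "j < n"
  shows "growth E n k s L\<^sub>0 (visit E k (Suc s) i j \<sigma>)"
proof -
  obtain L c where \<sigma>: "\<sigma> = (L, c)" by fastforce
  show ?thesis
  proof (cases "(i, j) \<in> E \<and> L i = Suc s \<and> L j = 0 \<and> c < k")
    case True
    have fiber: "L(j := Suc s) -` {Suc s} = insert j (L -` {Suc s})"
      by auto
    have "finite (L -` {Suc s})"
      using assms(1) finite_fiber[of L n] by (auto simp: growth_def \<sigma>)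
    then have "card (insert j (L -` {Suc s})) = Suc (card (L -` {Suc s}))"
      using True by (intro card_insert_disjoint) auto
    moreover have "connected_from E s (insert j (L -` {Suc s}))"
      using assms(1) True by (intro connected_from_insert[where u = i]) (auto simp: growth_def \<sigma>)
    moreover have "L\<^sub>0 j = 0"
    proof -
      have "L j = L\<^sub>0 j \<or> L j = Suc s"
        using assms(1) by (auto simp: growth_def \<sigma>)
      then show ?thesis
        using True by auto
    qed
    ultimately show ?thesis
      using assms True unfolding growth_def visit_def \<sigma> by (auto simp: fiber)
  next
    case False
    then show ?thesis
      using assms(1) unfolding visit_def \<sigma> by auto
  qed
qed

lemma growth_sweep:
  assumes "growth E n k s L\<^sub>0 \<sigma>"
  shows "growth E n k s L\<^sub>0 (sweep E n k (Suc s) \<sigma>)"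
proof -
  have "growth E n k s L\<^sub>0 (fold (visit E k (Suc s) i) [0..<n] \<tau>)" if "growth E n k s L\<^sub>0 \<tau>" for i \<tau>
    by (rule fold_invariant[where P = "growth E n k s L\<^sub>0" and Q = "\<lambda>j. j < n"])
      (simp_all add: that growth_visit)
  then show ?thesis
    unfolding sweep_def
    by (rule fold_invariant[where P = "growth E n k s L\<^sub>0" and Q = "\<lambda>_. True", rotated 2])
      (simp_all add: assms)
qed

text \<open>Labels so far are at most \<open>s\<close>, so \<open>Suc s\<close> is fresh and its
  fiber is empty or \<open>{s}\<close>.\<close>

lemma growth_seed:
  assumes "\<And>v. L v \<le> s" "\<And>v. L v \<noteq> 0 \<Longrightarrow> v < n" "s < n" "0 < k"
  shows "growth E n k s L (seed s L)"
proof -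
  have "L v \<noteq> Suc s" for v
    using assms(1)[of v] by auto
  then have "L -` {Suc s} = {}" "L(s := Suc s) -` {Suc s} = {s}"
    by (auto split: if_splits)
  then show ?thesis
    using assms unfolding growth_def seed_def
    by (auto simp: connected_from_def)
qed

lemma grow_result:
  assumes L: "\<And>v. L v \<le> s" "\<And>v. L v \<noteq> 0 \<Longrightarrow> v < n" and s: "s < n" and k: "0 < k"
    and grow: "grow E n k s L = (L', c)"
  shows "growth E n k s L (L', c)" "L' s \<noteq> 0"
    and "c < k \<Longrightarrow> (u, v) \<in> E \<Longrightarrow> v < n \<Longrightarrow> L' u = Suc s \<Longrightarrow> L' v \<noteq> 0"
proof -
  let ?\<sigma> = "\<lambda>r. (sweep E n k (Suc s) ^^ r) (seed s L)"
  have inv: "growth E n k s L (?\<sigma> r)" for r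
    by (induction r) (simp_all add: growth_seed[OF L s k] growth_sweep)
  have result: "?\<sigma> k = (L', c)"
    using grow by (simp add: grow_def)
  then show g: "growth E n k s L (L', c)"
    using inv[of k] by simp
  \<comment> \<open>A block seeded with one vertex stays nonempty; with \<open>root\<close> below,
    it then contains \<open>s\<close>.\<close>
  have mono: "snd (seed s L) \<le> snd (?\<sigma> r)" for r
  proof (induction r)
    case (Suc r)
    moreover have "snd (?\<sigma> r) \<le> snd (?\<sigma> (Suc r))"
      using progressive_sweep[of E n k "Suc s"] unfolding progressive_def funpow.simps o_apply by blast
    ultimately show ?case
      by (rule le_trans)
  qed simp
  have L': "L' v = L v \<or> L v = 0 \<and> L' v = Suc s" "L' v \<noteq> 0 \<Longrightarrow> v < n" for v
    using g by (auto simp: growth_def)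
  have root: "L' s = Suc s" if "L' u = Suc s" for u
    using g that connected_from_root[of E s "L' -` {Suc s}" u] by (simp add: growth_def)
  show s': "L' s \<noteq> 0"
  proof (cases "L s = 0")
    case True
    then have "card (L' -` {Suc s}) \<noteq> 0"
      using mono[of k] g result by (simp add: seed_def growth_def)
    then obtain v where "L' v = Suc s"
      by (metis card.empty equals0I vimage_singleton_eq)
    then show ?thesis
      using root by simp
  next
    case False
    then show ?thesis
      using L'(1)[of s] by simp
  qed
  show "L' v \<noteq> 0" if "c < k" "(u, v) \<in> E" "v < n" "L' u = Suc s"
  proof -
    \<comment> \<open>An earlier label of \<open>s\<close> would have been kept and is at most
      \<open>s\<close>, whereas a nonempty block gives \<open>L' s = Suc s\<close>.\<close>
    have "L s = 0"
      using root[OF that(4)] L(1)[of s] L'(1)[of s] by auto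
    \<comment> \<open>The count started at 1, so \<open>k\<close> productive sweeps would give at
      least \<open>k + 1\<close>. Hence the state is a fixed point.\<close>
    then have "\<not> snd (seed s L) + k \<le> c"
      using that(1) by (simp add: seed_def)
    then have "sweep E n k (Suc s) (L', c) = (L', c)"
      using progressive_funpow[OF progressive_sweep[of E n k "Suc s"], of k "seed s L"] result by auto
    moreover have "u < n"
      using L'(2)[of u] that(4) by simp
    ultimately show ?thesis
      using sweep_fixed_closed that by metis
  qed
qed

section \<open>Invariant of the whole greedy run\<close>

text \<open>The bound \<open>L v \<le> Suc b\<close> records that neighbours of a small block lie in
  it or in earlier blocks; it persists because assigned labels never change. Empty fibers count as
  small blocks and add 0 to \<open>t\<close>.\<close>

definition block_labelling :: "nat rel \<Rightarrow> nat \<Rightarrow> nat \<Rightarrow> nat \<Rightarrow> (nat \<Rightarrow> nat) \<times> nat \<Rightarrow> bool" where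
  "block_labelling E n k s = (\<lambda>(L, t).
     (\<forall>v. L v \<le> s \<and> (L v \<noteq> 0 \<longrightarrow> v < n)) \<and> (\<forall>v<s. L v \<noteq> 0) \<and>
     (\<forall>b<s. card (L -` {Suc b}) \<le> k \<and> connected_from E b (L -` {Suc b}) \<and>
        (card (L -` {Suc b}) < k \<longrightarrow>
           (\<forall>u v. (u, v) \<in> E \<longrightarrow> v < n \<longrightarrow> L u = Suc b \<longrightarrow> L v \<noteq> 0 \<and> L v \<le> Suc b))) \<and>
     t = (\<Sum>b<s. if card (L -` {Suc b}) < k then 0 else card (L -` {Suc b})))"

lemma block_labelling_harvest:
  assumes "block_labelling E n k s \<sigma>" "s < n" "0 < k"
  shows "block_labelling E n k (Suc s) (harvest E n k s \<sigma>)"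
proof -
  obtain L t where \<sigma>: "\<sigma> = (L, t)" by fastforce
  obtain L' c where grow: "grow E n k s L = (L', c)" by fastforce
  have old: "L v \<le> s" "L v \<noteq> 0 \<Longrightarrow> v < n" "v < s \<Longrightarrow> L v \<noteq> 0" for v
    using assms(1) by (auto simp: block_labelling_def \<sigma>)
  note g = grow_result[OF old(1,2) assms(2,3) grow]
  have new: "L' v = L v \<or> L v = 0 \<and> L' v = Suc s" "L' v \<noteq> 0 \<Longrightarrow> v < n" for v
    using g(1) by (auto simp: growth_def)
  have c: "c = card (L' -` {Suc s})" "c \<le> k" "connected_from E s (L' -` {Suc s})"
    using g(1) by (auto simp: growth_def)
  have le: "L' v \<le> Suc s" for v
    using new(1)[of v] old(1)[of v] by auto
  \<comment> \<open>Round \<open>s\<close> only hands out the label \<open>Suc s\<close>, so earlier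
    blocks are untouched.\<close>
  have fiber: "L' -` {Suc b} = L -` {Suc b}" if "b < s" for b
  proof -
    have "L' v = Suc b \<longleftrightarrow> L v = Suc b" for v
      using new(1)[of v] that by auto
    then show ?thesis by auto
  qed
  have nonzero: "L' v \<noteq> 0" if "v < Suc s" for v
    using that g(2) new(1)[of v] old(3)[of v] by (cases "v = s") auto
  have blocks: "card (L' -` {Suc b}) \<le> k \<and> connected_from E b (L' -` {Suc b}) \<and>
      (card (L' -` {Suc b}) < k \<longrightarrow>
        (\<forall>u v. (u, v) \<in> E \<longrightarrow> v < n \<longrightarrow> L' u = Suc b \<longrightarrow> L' v \<noteq> 0 \<and> L' v \<le> Suc b))"
    if "b < Suc s" for b
  proof (cases "b = s")
    case True
    \<comment> \<open>For the newest block the order condition is automatic, since no label exceeds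
      \<open>Suc s\<close> yet.\<close>
    then show ?thesis
      using c g(3) le by auto
  next
    case False
    then have b: "b < s"
      using that by simp
    have old_block: "card (L -` {Suc b}) \<le> k \<and> connected_from E b (L -` {Suc b}) \<and>
      (card (L -` {Suc b}) < k \<longrightarrow>
        (\<forall>u v. (u, v) \<in> E \<longrightarrow> v < n \<longrightarrow> L u = Suc b \<longrightarrow> L v \<noteq> 0 \<and> L v \<le> Suc b))"
      using assms(1) b unfolding block_labelling_def \<sigma> by blast
    moreover have "L u = Suc b" if "L' u = Suc b" for u
      using new(1)[of u] b that by auto
    moreover have "L' v \<noteq> 0 \<and> L' v \<le> Suc b" if "L v \<noteq> 0 \<and> L v \<le> Suc b" for v
      using new(1)[of v] that by auto
    ultimately show ?thesis
      unfolding fiber[OF b] by blast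
  qed
  have "(\<Sum>b<s. if card (L' -` {Suc b}) < k then 0 else card (L' -` {Suc b})) = t"
    using assms(1) fiber by (auto simp: block_labelling_def \<sigma> intro!: sum.cong)
  then have "(if c < k then t else t + c) =
      (\<Sum>b<Suc s. if card (L' -` {Suc b}) < k then 0 else card (L' -` {Suc b}))"
    using c(1) by simp
  then show ?thesis
    using le new(2) nonzero blocks unfolding block_labelling_def harvest_def \<sigma> by (simp add: grow)
qed

lemma block_labelling_greedy:
  assumes "0 < k"
  shows "block_labelling E n k n (greedy E n k)"
proof -
  have "block_labelling E n k s (fold (harvest E n k) [0..<s] (\<lambda>_. 0, 0))" if "s \<le> n" for s
    using that
  proof (induction s)
    case 0
    show ?case by (simp add: block_labelling_def)
  next
    case (Suc s)
    then show ?case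
      using block_labelling_harvest[OF _ _ assms] by simp
  qed
  then show ?thesis
    by (simp add: greedy_def)
qed

section \<open>Component independent sets\<close>

text \<open>By induction along paths, \<open>f\<close> is constant on every component, so each
  component lies inside one fiber. The components themselves need not be determined.\<close>

lemma component_independentI:
  assumes "wf_digraph G" "finite S" "S \<subseteq> verts G"
    and adj: "\<And>u v. u \<in> S \<Longrightarrow> v \<in> S \<Longrightarrow> (u, v) \<in> arcs_ends G \<Longrightarrow> f u = f v"
    and card: "\<And>u. u \<in> S \<Longrightarrow> card {v \<in> S. f v = f u} \<le> m"
  shows "component_independent G m S"
  unfolding component_independent_def
proof (intro conjI ballI)
  interpret wf_digraph G by fact
  interpret GS: wf_digraph "G \<restriction> S"
    by (rule wellformed_induce_subgraph)
  fix C
  assume "C \<in> pre_digraph.sccs (G \<restriction> S)"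
  then have C: "subgraph C (G \<restriction> S)" "strongly_connected C"
    by (auto simp: pre_digraph.sccs_def induced_subgraph_def)
  then obtain u where u: "u \<in> verts C"
    by (auto simp: strongly_connected_def)
  have sub: "verts C \<subseteq> S"
    using C(1) by (auto simp: subgraph_def)
  have "f v = f u" if "v \<in> verts C" for v
  proof -
    have "u \<rightarrow>\<^sup>*\<^bsub>C\<^esub> v"
      using C(2) u that by (auto simp: strongly_connected_def)
    then have "u \<rightarrow>\<^sup>*\<^bsub>G \<restriction> S\<^esub> v"
      using C(1) by (rule GS.reachable_mono)
    then show ?thesis
    proof (induction rule: GS.reachable_induct)
      case (step x y)
      then have "x \<in> S" "y \<in> S" "(x, y) \<in> arcs_ends G"
        by (auto simp: arcs_ends_conv)
      then show ?case
        using adj step by metis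
    qed simp
  qed
  then have "verts C \<subseteq> {v \<in> S. f v = f u}"
    using sub by auto
  then have "card (verts C) \<le> card {v \<in> S. f v = f u}"
    using assms(2) by (intro card_mono) auto
  then show "card (verts C) \<le> m"
    using card u sub by (meson le_trans subsetD)
qed fact

text \<open>Mutual reachability puts \<open>T\<close> inside the component of any one of its
  vertices. Used to show that a feasible set cannot contain a connected block of \<open>k\<close>
  vertices.\<close>

lemma component_independent_card_le:
  assumes "wf_digraph G" "finite S" "component_independent G m S" "T \<subseteq> S"
    and "\<And>u v. u \<in> T \<Longrightarrow> v \<in> T \<Longrightarrow> u \<rightarrow>\<^sup>*\<^bsub>G \<restriction> S\<^esub> v"
  shows "card T \<le> m"
proof (cases "T = {}")
  case False
  then obtain u where u: "u \<in> T" by auto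
  have S: "S \<subseteq> verts G"
    using assms(3) by (simp add: component_independent_def)
  interpret wf_digraph G by fact
  interpret GS: wf_digraph "G \<restriction> S"
    by (rule wellformed_induce_subgraph)
  have "GS.scc_of u \<in> GS.sccs_verts"
    using u assms(4) by (intro GS.scc_of_in_sccs_verts) auto
  then obtain C where C: "C \<in> GS.sccs" "verts C = GS.scc_of u"
    unfolding GS.sccs_verts_conv by auto
  have "T \<subseteq> verts C"
    using assms(5) u by (auto simp: C(2) GS.scc_of_def)
  moreover have "finite (verts C)"
    using C(1) assms(2) finite_subset[of "verts C" S]
    by (auto simp: GS.sccs_def induced_subgraph_def subgraph_def)
  moreover have "card (verts C) \<le> m"
    using C(1) assms(3) by (simp add: component_independent_def)
  ultimately show ?thesis
    by (meson card_mono le_trans)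
qed simp

text \<open>Route through the root: symmetry reverses the path from \<open>s\<close> to
  \<open>u\<close>, and the path from \<open>s\<close> to \<open>v\<close> follows.\<close>

lemma connected_from_reachable:
  assumes "pair_sym_digraph G" "T \<subseteq> S" "S \<subseteq> pverts G" "connected_from (parcs G) s T" "u \<in> T" "v \<in> T"
  shows "u \<rightarrow>\<^sup>*\<^bsub>with_proj G \<restriction> S\<^esub> v"
proof -
  interpret pair_sym_digraph G by fact
  have "sym_digraph (with_proj G \<restriction> S)"
    using assms(3) by (intro induced_graph_imp_graph induced_induce) simp
  then interpret GS: sym_digraph "with_proj G \<restriction> S" .
  have "s \<in> T"
    using assms(4,5) by (rule connected_from_root)
  have from_s: "s \<rightarrow>\<^sup>*\<^bsub>with_proj G \<restriction> S\<^esub> x" if "x \<in> T" for x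
  proof -
    have "(s, x) \<in> (parcs G \<inter> T \<times> T)\<^sup>*"
      using assms(4) that by (simp add: connected_from_def)
    then show ?thesis
    proof (induction rule: rtrancl_induct)
      case base
      then show ?case
        using \<open>s \<in> T\<close> assms(2) by auto
    next
      case (step y z)
      then have "(y, z) \<in> arcs_ends (with_proj G \<restriction> S)"
        using assms(2) by (force simp: arcs_ends_conv)
      with step.IH show ?case
        by (rule GS.reachable_adj_trans)
    qed
  qed
  show ?thesis
    using GS.symmetric_reachable'[OF from_s[OF assms(5)]] from_s[OF assms(6)] by (rule GS.reachable_trans)
qed

lemma greedy_approximation:
  assumes G: "pair_graph G" "pverts G = {0..<n}" and k: "0 < k"
    and L: "block_labelling (parcs G) n k n (L, t)"
  defines "opt \<equiv> n - component_independence_number (k - 1) (with_proj G)"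
  shows "opt \<le> t" "t \<le> k * opt"
proof -
  have sym_digraph: "pair_sym_digraph G"
    using G(1) by (simp add: pair_graph_def pair_pseudo_graph_def)
  have wf: "wf_digraph (with_proj G)"
    using sym_digraph by (auto simp: pair_sym_digraph_def pair_wf_digraph_def wf_digraph_def)
  let ?G = "with_proj G"
  let ?M = "{card S | S. component_independent ?G (k - 1) S}"
  define B where "B b = L -` {Suc b}" for b
  define full where "full = {b. b < n \<and> \<not> card (B b) < k}"
  define S where "S = {0..<n} - (\<Union>b\<in>full. B b)"
  have L_le: "L v \<le> n" "L v \<noteq> 0 \<longleftrightarrow> v < n" for v
    using L unfolding block_labelling_def by blast+
  have block: "card (B b) \<le> k" "connected_from (parcs G) b (B b)" if "b < n" for b
    using L that unfolding block_labelling_def B_def by blast+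
  have closed: "L v \<le> Suc b" if "b < n" "card (B b) < k" "(u, v) \<in> parcs G" "v < n" "L u = Suc b" for b u v
    using L that unfolding block_labelling_def B_def by blast
  have full: "card (B b) = k" if "b \<in> full" for b
    using block(1)[of b] that by (auto simp: full_def)
  have sub: "B b \<subseteq> {0..<n}" for b
    using L_le(2) by (force simp: B_def)
  then have finB: "finite (B b)" for b
    using finite_subset by blast
  have fin: "finite ?M" and ne: "?M \<noteq> {}"
    using finite_component_independent_cards[of ?G] component_independent_cards_nonempty[of ?G] G(2)
    by auto
  have [simp]: "finite full"
    by (simp add: full_def)
  have t: "t = k * card full"
  proof -
    have "t = (\<Sum>b<n. if card (B b) < k then 0 else card (B b))"
      using L unfolding block_labelling_def B_def by blast
    also have "\<dots> = (\<Sum>b\<in>full. card (B b))"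
      by (rule sum.mono_neutral_cong_right) (auto simp: full_def)
    also have "\<dots> = k * card full"
      using full by simp
    finally show ?thesis .
  qed
  have disjoint: "B b \<inter> B b' = {}" if "b \<noteq> b'" for b b'
    using that by (auto simp: B_def)
  have "component_independent ?G (k - 1) S"
  proof (rule component_independentI[where f = L])
    show "wf_digraph ?G" by fact
    show "finite S" "S \<subseteq> verts ?G"
      using G(2) by (auto simp: S_def)
    \<comment> \<open>After \<open>n\<close> rounds every vertex is labelled, so whatever lies
      outside the full blocks lies in a small one.\<close>
    have small: "\<exists>b<n. L u = Suc b \<and> card (B b) < k" if u: "u \<in> S" for u
    proof -
      have "L u \<noteq> 0"
        using u L_le(2)[of u] by (auto simp: S_def)
      then obtain b where b: "L u = Suc b"
        using not0_implies_Suc by blast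
      then have "b < n"
        using L_le(1)[of u] by simp
      moreover have "b \<notin> full"
        using u b by (auto simp: S_def B_def)
      ultimately show ?thesis
        using b by (auto simp: full_def)
    qed
    \<comment> \<open>The block of \<open>u\<close> is small, so its neighbours are not in later
      blocks. The reverse arc gives the opposite inequality.\<close>
    have le: "L v \<le> L u" if "u \<in> S" "v \<in> S" "(u, v) \<in> parcs G" for u v
      using small[OF that(1)] closed[of _ u v] that by (auto simp: S_def)
    show "L u = L v" if "u \<in> S" "v \<in> S" "(u, v) \<in> arcs_ends ?G" for u v
    proof -
      have "(u, v) \<in> parcs G"
        using that(3) by simp
      moreover have "(v, u) \<in> parcs G"
        using \<open>(u, v) \<in> parcs G\<close> pair_sym_digraph.pair_sym_arcs[OF sym_digraph]
        by (auto simp: symmetric_def sym_def)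
      ultimately show ?thesis
        using le that by (meson le_antisym)
    qed
    show "card {v \<in> S. L v = L u} \<le> k - 1" if "u \<in> S" for u
    proof -
      obtain b where b: "L u = Suc b" "card (B b) < k"
        using small[OF \<open>u \<in> S\<close>] by auto
      have "card {v \<in> S. L v = L u} \<le> card (B b)"
        using b(1) finB by (intro card_mono) (auto simp: B_def)
      then show ?thesis
        using b(2) by simp
    qed
  qed
  then have "card S \<le> component_independence_number (k - 1) ?G"
    unfolding component_independence_number_def using fin by (intro Max_ge) auto
  moreover have "card S = n - t"
  proof -
    have "card (\<Union>b\<in>full. B b) = (\<Sum>b\<in>full. card (B b))"
      using disjoint by (intro card_UN_disjoint) (auto simp: finB)
    then have "card (\<Union>b\<in>full. B b) = t"
      using full t by simp
    then show ?thesis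
      using sub unfolding S_def by (subst card_Diff_subset) (auto simp: finB)
  qed
  ultimately show "opt \<le> t"
    unfolding opt_def by simp
  obtain S' where S': "component_independent ?G (k - 1) S'"
      "component_independence_number (k - 1) ?G = card S'"
    using Max_in[OF fin ne] unfolding component_independence_number_def by auto
  have S'_sub: "S' \<subseteq> {0..<n}"
    using S'(1) G(2) by (simp add: component_independent_def)
  have hit: "\<exists>v. v \<in> B b - S'" if "b \<in> full" for b
  proof (rule ccontr)
    assume "\<not> ?thesis"
    then have "B b \<subseteq> S'" by auto
    then have "card (B b) \<le> k - 1"
      using S'(1) S'_sub block(2)[of b] that G(2) finite_subset[OF S'_sub]
      by (intro component_independent_card_le[of ?G S'] connected_from_reachable)
        (auto simp: full_def intro: wf sym_digraph)
    then show False
      using full[OF that] k by simp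
  qed
  \<comment> \<open>One deleted vertex per full block; disjointness of the blocks makes the choice
    injective.\<close>
  define g where "g b = (SOME v. v \<in> B b - S')" for b
  have g: "g b \<in> B b - S'" if "b \<in> full" for b
    unfolding g_def using hit[OF that] by (rule someI_ex)
  have "card full \<le> card ({0..<n} - S')"
  proof (rule card_inj_on_le)
    show "inj_on g full"
      using g disjoint by (intro inj_onI) (metis DiffD1 IntI empty_iff)
    show "g ` full \<subseteq> {0..<n} - S'"
      using g sub by blast
  qed simp
  also have "\<dots> = opt"
    using S'_sub S'(2) unfolding opt_def by (subst card_Diff_subset) (auto intro: finite_subset)
  finally show "t \<le> k * opt"
    using t by simp
qed

section \<open>The machine program\<close>

text \<open>Register 3 must hold the constant 1. The test comes after the body, so the bound in
  register \<open>m\<close> has to be positive.\<close>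

definition For :: "nat \<Rightarrow> nat \<Rightarrow> com \<Rightarrow> com" where
  "For i m c = Block [Const i 0] ;; Do_While (c ;; Block [Add i i 3, Sub 11 m i]) 11"

text \<open>The update in the postcondition of the body anticipates the increment and the comparison
  that \<open>For\<close> appends, so users never reason about them. The 3 in the bound pays for
  these two instructions and the jump.\<close>

lemma triple_For:
  assumes body: "\<And>v. v < N \<Longrightarrow> triple (\<lambda>X w. I v X w \<and> X i = v) c t
      (\<lambda>X w. X i = v \<and> X 3 = 1 \<and> X m = N \<and> I (Suc v) (X(i := Suc v, 11 := N - Suc v)) w)"
    and init: "\<And>X w. P X w \<Longrightarrow> I 0 (X(i := 0)) w"
    and "0 < N" "i \<notin> {3, 11, m}" "m \<noteq> 11"
  shows "triple P (For i m c) (1 + N * (t + 3)) (I N)"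
proof -
  let ?J = "\<lambda>v X w. I v X w \<and> X i = v"
  have "triple P (Block [Const i 0]) (length [Const i 0]) (?J 0)"
    using init by (intro triple_Block) auto
  moreover have "triple (?J 0) (Do_While (c ;; Block [Add i i 3, Sub 11 m i]) 11)
      ((N - 0) * Suc (t + length [Add i i 3, Sub 11 m i])) (I N)"
  proof (rule triple_Do_While[where I = ?J])
    fix v
    assume v: "v < N"
    show "triple (?J v) (c ;; Block [Add i i 3, Sub 11 m i]) (t + length [Add i i 3, Sub 11 m i])
        (\<lambda>X w. if X 11 = 0 then I N X w else Suc v < N \<and> ?J (Suc v) X w)"
    proof (rule triple_Seq[OF body[OF v]], rule triple_Block)
      fix X w
      assume *: "X i = v \<and> X 3 = 1 \<and> X m = N \<and> I (Suc v) (X(i := Suc v, 11 := N - Suc v)) w"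
      then have "fold effect [Add i i 3, Sub 11 m i] (X, w) = (X(i := Suc v, 11 := N - Suc v), w)"
        using assms(4) by auto
      moreover have "N = Suc v" if "N - Suc v = 0"
        using that v by simp
      ultimately show "case fold effect [Add i i 3, Sub 11 m i] (X, w) of (X', w') \<Rightarrow>
          if X' 11 = 0 then I N X' w' else Suc v < N \<and> ?J (Suc v) X' w'"
        using * assms(4) by auto
    qed simp
  qed fact
  ultimately have "triple P (For i m c) (length [Const i 0] + (N - 0) * Suc (t + length [Add i i 3, Sub 11 m i])) (I N)"
    unfolding For_def by (rule triple_Seq)
  then show ?thesis
    by (rule triple_consequence) (simp_all add: eval_nat_numeral)
qed

text \<open>Registers: 0 holds the output, 1 and 2 hold \<open>n\<close> and \<open>k\<close>, 3 and 14 the constants 1 and 16;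
  4 to 7 are the loop counters \<open>s\<close>, round, \<open>i\<close>, \<open>j\<close>; 8 points into the adjacency matrix, 9 is the size of
  the current block and 10 its label; 11 to 13 are scratch. The labelling is stored from address 16 on, followed by the matrix.\<close>

text \<open>A sum of truncated differences in register 13 that vanishes iff the guard of \<open>visit\<close> holds.\<close>

definition "visit_test =
  [Load 13 8, Sub 13 3 13,
   Add 12 6 14, Load 11 12, Sub 12 11 10, Add 13 13 12, Sub 12 10 11, Add 13 13 12,
   Add 12 7 14, Load 11 12, Add 13 13 11,
   Sub 11 2 9, Sub 11 3 11, Add 13 13 11]"

text \<open>\<open>visit_test\<close> leaves the address \<open>j + 16\<close> of the label of
  \<open>j\<close> in register 12, where \<open>Store\<close> uses it. The matrix pointer advances
  on both branches.\<close>

definition "visit_com =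
  Block visit_test ;; Unless 13 (Block [Store 12 10, Add 9 9 3]) ;; Block [Add 8 8 3]"

definition "sweep_com = Block [Add 8 1 14] ;; For 6 1 (For 7 1 visit_com)"

text \<open>The last test holds \<open>k - c\<close>, which is positive for a small block, so only
  full blocks are added to the output.\<close>

definition "harvest_com =
  Block [Add 10 4 3, Const 9 0, Add 12 4 14, Load 11 12] ;;
  Unless 11 (Block [Store 12 10, Const 9 1]) ;;
  For 5 2 sweep_com ;;
  Block [Sub 11 2 9] ;;
  Unless 11 (Block [Add 0 0 9])"

text \<open>The unary prefix is summed into register 1, its closing 0 adding nothing. In the second
  loop \<open>2 - x\<close> is positive for a bit and 0 for the end marker 2. The parameter
  \<open>k\<close> is a literal of the program.\<close>

definition "read_com k =
  Block [Const 3 1] ;;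
  Do_While (Block [Read 11, Add 1 1 11]) 11 ;;
  Block [Const 2 k, Const 14 16, Add 8 1 14] ;;
  Do_While (Block [Read 11, Store 8 11, Add 8 8 3, Const 12 2, Sub 11 12 11]) 11"

definition "greedy_com k = read_com k ;; For 4 1 harvest_com"

definition stored :: "nat rel \<Rightarrow> nat \<Rightarrow> nat \<Rightarrow> (nat \<Rightarrow> nat) \<Rightarrow> nat \<Rightarrow> (nat \<Rightarrow> nat) \<Rightarrow> bool" where
  "stored E n k L t X \<longleftrightarrow>
     X 0 = t \<and> X 1 = n \<and> X 2 = k \<and> X 3 = 1 \<and> X 14 = 16 \<and> (\<forall>v<n. X (v + 16) = L v) \<and>
     (\<forall>i<n. \<forall>j<n. X (n + 16 + (i * n + j)) = of_bool ((i, j) \<in> E))"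

definition growing :: "nat rel \<Rightarrow> nat \<Rightarrow> nat \<Rightarrow> nat \<Rightarrow> nat \<Rightarrow> (nat \<Rightarrow> nat) \<times> nat \<Rightarrow> (nat \<Rightarrow> nat) \<Rightarrow> bool" where
  "growing E n k t s \<sigma> X \<longleftrightarrow>
     stored E n k (fst \<sigma>) t X \<and> X 4 = s \<and> X 9 = snd \<sigma> \<and> X 10 = Suc s"

text \<open>Frame rule: registers 4 to 13 hold only counters, pointers and temporaries.\<close>

lemma stored_scratch [simp]:
  assumes "3 < a" "a < 14"
  shows "stored E n k L t (X(a := x)) \<longleftrightarrow> stored E n k L t X"
  using assms by (simp add: stored_def)

lemma stored_label:
  assumes "stored E n k L t X" "v < n"
  shows "stored E n k (L(v := x)) t (X(v + 16 := x))"
  using assms by (auto simp: stored_def)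

lemma fold_visit_test:
  assumes "stored E n k L t X" "i < n" "j < n"
    and "X 6 = i" "X 7 = j" "X 8 = n + 16 + (i * n + j)" "X 9 = c" "X 10 = b"
  obtains x y where "fold effect visit_test (X, w) = (X(13 := x, 12 := j + 16, 11 := y), w)"
    and "x = 0 \<longleftrightarrow> (i, j) \<in> E \<and> L i = b \<and> L j = 0 \<and> c < k"
proof
  have X: "X 2 = k" "X 3 = 1" "X 14 = 16" "X (i + 16) = L i" "X (j + 16) = L j"
      "X (n + 16 + (i * n + j)) = of_bool ((i, j) \<in> E)"
    using assms(1-3) by (simp_all add: stored_def)
  \<comment> \<open>The two opposite truncated differences vanish together iff
    \<open>L i = b\<close>; the last summand vanishes iff \<open>c < k\<close>.\<close>
  let ?x = "1 - of_bool ((i, j) \<in> E) + (L i - b) + (b - L i) + L j + (1 - (k - c))"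
  show "fold effect visit_test (X, w) = (X(13 := ?x, 12 := j + 16, 11 := 1 - (k - c)), w)"
    by (simp add: visit_test_def X assms fun_eq_iff)
  show "?x = 0 \<longleftrightarrow> (i, j) \<in> E \<and> L i = b \<and> L j = 0 \<and> c < k"
    by auto
qed

text \<open>The 18 steps are 14 for the test, 1 for the jump, 2 for the assignment and 1 for the
  pointer.\<close>

lemma triple_visit:
  assumes "i < n" "j < n"
  shows "triple
    (\<lambda>X w. growing E n k t s \<sigma> X \<and> X 5 = r \<and> X 6 = i \<and> X 7 = j \<and> X 8 = n + 16 + (i * n + j))
    visit_com 18
    (\<lambda>X w. growing E n k t s (visit E k (Suc s) i j \<sigma>) X \<and> X 5 = r \<and> X 6 = i \<and> X 7 = j \<and>
       X 8 = n + 16 + (i * n + Suc j))"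
    (is "triple ?P _ _ ?Q")
proof -
  obtain L c where \<sigma>: "\<sigma> = (L, c)" by fastforce
  define cond where "cond \<longleftrightarrow> (i, j) \<in> E \<and> L i = Suc s \<and> L j = 0 \<and> c < k"
  have visit: "visit E k (Suc s) i j (L, c) = (if cond then (L(j := Suc s), Suc c) else (L, c))"
    by (simp add: visit_def cond_def)
  let ?R = "\<lambda>X w. ?P X w \<and> X 12 = j + 16 \<and> (X 13 = 0 \<longleftrightarrow> cond)"
  let ?S = "\<lambda>X w. growing E n k t s (visit E k (Suc s) i j \<sigma>) X \<and> X 5 = r \<and> X 6 = i \<and> X 7 = j \<and>
       X 8 = n + 16 + (i * n + j)"
  have "triple ?P (Block visit_test) (length visit_test) ?R"
  proof (rule triple_Block)
    show "list_all jump_free visit_test"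
      by (simp add: visit_test_def)
    fix X w
    assume P: "?P X w"
    then obtain x y where "fold effect visit_test (X, w) = (X(13 := x, 12 := j + 16, 11 := y), w)"
        "x = 0 \<longleftrightarrow> cond"
      using fold_visit_test[where w = w and c = c and b = "Suc s", OF _ assms]
      unfolding growing_def \<sigma> cond_def fst_conv snd_conv by blast
    then show "case fold effect visit_test (X, w) of (X', w') \<Rightarrow> ?R X' w'"
      using P by (simp add: growing_def)
  qed
  moreover have "triple ?R (Unless 13 (Block [Store 12 10, Add 9 9 3])) (Suc (length [Store 12 10, Add 9 9 3])) ?S"
  proof (intro triple_Unless triple_Block)
    fix X w
    assume R: "?R X w \<and> X 13 = 0"
    have "stored E n k (L(j := Suc s)) t (X(j + 16 := Suc s))"
      using R assms(2) by (intro stored_label) (auto simp: growing_def \<sigma>)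
    moreover have cond
      using R by blast
    ultimately show "case fold effect [Store 12 10, Add 9 9 3] (X, w) of (X', w') \<Rightarrow> ?S X' w'"
      using R by (simp add: visit growing_def \<sigma>) (simp add: stored_def)
  next
    fix X w
    assume "?R X w" "X 13 > 0"
    then show "?S X w"
      by (simp add: visit \<sigma>)
  qed simp
  moreover have "triple ?S (Block [Add 8 8 3]) (length [Add 8 8 3]) ?Q"
    by (intro triple_Block) (simp_all add: growing_def, simp add: stored_def)
  ultimately have "triple ?P visit_com
      (length visit_test + (Suc (length [Store 12 10, Add 9 9 3]) + length [Add 8 8 3])) ?Q"
    unfolding visit_com_def by (intro triple_Seq)
  then show ?thesis
    by (rule triple_consequence) (simp_all add: visit_test_def)
qed

lemma triple_sweep:
  assumes "0 < n"
  shows "triple (\<lambda>X w. growing E n k t s \<sigma> X \<and> X 5 = r) sweep_com (2 + n * (4 + n * 21))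
    (\<lambda>X w. growing E n k t s (sweep E n k (Suc s) \<sigma>) X \<and> X 5 = r)"
    (is "triple ?P _ _ ?Q")
proof -
  let ?rows = "\<lambda>i. fold (\<lambda>i. fold (visit E k (Suc s) i) [0..<n]) [0..<i] \<sigma>"
  let ?cells = "\<lambda>i j. fold (visit E k (Suc s) i) [0..<j] (?rows i)"
  let ?J = "\<lambda>i j X w. growing E n k t s (?cells i j) X \<and> X 5 = r \<and> X 6 = i \<and> X 8 = n + 16 + (i * n + j)"
  let ?I = "\<lambda>i X w. growing E n k t s (?rows i) X \<and> X 5 = r \<and> X 8 = n + 16 + i * n"
  have cell: "triple (\<lambda>X w. ?J i j X w \<and> X 7 = j) visit_com 18
      (\<lambda>X w. X 7 = j \<and> X 3 = 1 \<and> X 1 = n \<and> ?J i (Suc j) (X(7 := Suc j, 11 := n - Suc j)) w)"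
    if "i < n" "j < n" for i j
    by (rule triple_consequence[OF triple_visit[OF that, of E k t s "?cells i j" r]])
      (auto simp: growing_def stored_def)
  \<comment> \<open>The pointer behind row \<open>i\<close> is at \<open>i * n + n\<close>, the
    start of row \<open>Suc i\<close>, so it needs no adjustment between rows.\<close>
  have row: "triple (\<lambda>X w. ?I i X w \<and> X 6 = i) (For 7 1 visit_com) (1 + n * (18 + 3))
      (\<lambda>X w. X 6 = i \<and> X 3 = 1 \<and> X 1 = n \<and> ?I (Suc i) (X(6 := Suc i, 11 := n - Suc i)) w)"
    if "i < n" for i
  proof -
    have "triple (\<lambda>X w. ?I i X w \<and> X 6 = i) (For 7 1 visit_com) (1 + n * (18 + 3)) (?J i n)"
      by (rule triple_For[where I = "?J i", OF cell[OF that]]) (use assms in \<open>simp_all add: growing_def\<close>)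
    then show ?thesis
      by (rule triple_consequence) (auto simp: growing_def, auto simp: stored_def)
  qed
  have "triple (?I 0) (For 6 1 (For 7 1 visit_com)) (1 + n * (1 + n * (18 + 3) + 3)) (?I n)"
    by (rule triple_For[where I = ?I, OF row]) (use assms in \<open>simp_all add: growing_def\<close>)
  moreover have "triple ?P (Block [Add 8 1 14]) (length [Add 8 1 14]) (?I 0)"
    by (intro triple_Block) (simp_all add: growing_def, simp add: stored_def)
  ultimately have "triple ?P sweep_com (length [Add 8 1 14] + (1 + n * (1 + n * (18 + 3) + 3))) (?I n)"
    unfolding sweep_com_def by (intro triple_Seq)
  then show ?thesis
    by (rule triple_consequence) (simp_all add: sweep_def)
qed

lemma triple_harvest:
  assumes "0 < n" "0 < k" "s < n"
  shows "triple (\<lambda>X w. stored E n k (fst \<sigma>) (snd \<sigma>) X \<and> X 4 = s) harvest_com (11 + k * (5 + n * (4 + n * 21)))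
    (\<lambda>X w. stored E n k (fst (harvest E n k s \<sigma>)) (snd (harvest E n k s \<sigma>)) X \<and> X 4 = s)"
    (is "triple ?P _ _ ?Q")
proof -
  obtain L t where \<sigma>: "\<sigma> = (L, t)" by fastforce
  let ?rounds = "\<lambda>r. (sweep E n k (Suc s) ^^ r) (seed s L)"
  have harvest: "fst (harvest E n k s \<sigma>) = fst (?rounds k)"
      "snd (harvest E n k s \<sigma>) = (if snd (?rounds k) < k then t else t + snd (?rounds k))"
    by (simp_all add: harvest_def grow_def \<sigma> split: prod.split)
  let ?A = "\<lambda>X w. growing E n k t s (L, 0) X \<and> X 12 = s + 16 \<and> X 11 = L s"
  let ?B = "\<lambda>X w. growing E n k t s (seed s L) X"
  let ?C = "\<lambda>X w. growing E n k t s (?rounds k) X"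
  let ?D = "\<lambda>X w. ?C X w \<and> X 11 = k - snd (?rounds k)"
  have "triple ?P (Block [Add 10 4 3, Const 9 0, Add 12 4 14, Load 11 12])
      (length [Add 10 4 3, Const 9 0, Add 12 4 14, Load 11 12]) ?A"
    using assms(3) by (intro triple_Block) (auto simp: growing_def \<sigma>, auto simp: stored_def)
  moreover have "triple ?A (Unless 11 (Block [Store 12 10, Const 9 1]))
      (Suc (length [Store 12 10, Const 9 1])) ?B"
  proof (intro triple_Unless triple_Block)
    fix X w
    assume A: "?A X w \<and> X 11 = 0"
    then have "stored E n k (L(s := Suc s)) t (X(s + 16 := Suc s))"
      using assms(3) by (intro stored_label) (auto simp: growing_def)
    moreover have "L s = 0"
      using A by metis
    ultimately show "case fold effect [Store 12 10, Const 9 1] (X, w) of (X', w') \<Rightarrow> ?B X' w'"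
      using A by (simp add: seed_def growing_def)
  next
    fix X w
    assume "?A X w" "X 11 > 0"
    then show "?B X w"
      by (simp add: seed_def)
  qed simp
  moreover have "triple ?B (For 5 2 sweep_com) (1 + k * (2 + n * (4 + n * 21) + 3)) ?C"
  proof (rule triple_For[where I = "\<lambda>r X w. growing E n k t s (?rounds r) X"])
    show "triple (\<lambda>X w. growing E n k t s (?rounds r) X \<and> X 5 = r) sweep_com (2 + n * (4 + n * 21))
        (\<lambda>X w. X 5 = r \<and> X 3 = 1 \<and> X 2 = k \<and>
           growing E n k t s (?rounds (Suc r)) (X(5 := Suc r, 11 := k - Suc r)))" for r
      by (rule triple_consequence[OF triple_sweep[OF assms(1)]])
        (auto simp: growing_def, auto simp: stored_def)
  qed (use assms(2) in \<open>simp_all add: growing_def\<close>)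
  moreover have "triple ?C (Block [Sub 11 2 9]) (length [Sub 11 2 9]) ?D"
    by (intro triple_Block) (auto simp: growing_def, auto simp: stored_def)
  moreover have "triple ?D (Unless 11 (Block [Add 0 0 9])) (Suc (length [Add 0 0 9])) ?Q"
  proof (intro triple_Unless triple_Block)
    fix X w
    assume D: "?D X w \<and> X 11 = 0"
    then have "\<not> snd (?rounds k) < k"
      by linarith
    then show "case fold effect [Add 0 0 9] (X, w) of (X', w') \<Rightarrow> ?Q X' w'"
      using D by (simp add: harvest growing_def stored_def)
  next
    fix X w
    assume D: "?D X w" "X 11 > 0"
    then have "snd (?rounds k) < k"
      by linarith
    then show "?Q X w"
      using D by (simp add: harvest growing_def)
  qed simp
  ultimately have "triple ?P harvest_com
      (length [Add 10 4 3, Const 9 0, Add 12 4 14, Load 11 12] + (Suc (length [Store 12 10, Const 9 1]) +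
       ((1 + k * (2 + n * (4 + n * 21) + 3)) + (length [Sub 11 2 9] + Suc (length [Add 0 0 9]))))) ?Q"
    unfolding harvest_com_def by (intro triple_Seq)
  then show ?thesis
    by (rule triple_consequence) simp_all
qed

section \<open>Reading the input, and the complete program\<close>

lemma triple_read:
  assumes bits: "length bits = n * n"
    "\<And>i j. i < n \<Longrightarrow> j < n \<Longrightarrow> bits ! (i * n + j) \<longleftrightarrow> (i, j) \<in> E"
  shows "triple (\<lambda>X w. X = (\<lambda>_. 0) \<and> w = replicate n True @ False # bits) (read_com k)
    (4 + Suc n * 3 + Suc (n * n) * 6) (\<lambda>X w. stored E n k (\<lambda>_. 0) 0 X)"
    (is "triple ?P _ _ ?Q")
proof -
  let ?A = "\<lambda>v (X :: nat \<Rightarrow> nat) w. (\<forall>a. a \<notin> {1, 3, 11} \<longrightarrow> X a = 0) \<and> X 1 = v \<and> X 3 = 1 \<and>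
    w = replicate (n - v) True @ False # bits"
  let ?B = "\<lambda>(X :: nat \<Rightarrow> nat) w. (\<forall>a. a \<notin> {1, 3, 11} \<longrightarrow> X a = 0) \<and> X 1 = n \<and> X 3 = 1 \<and> w = bits"
  let ?C = "\<lambda>u (X :: nat \<Rightarrow> nat) w. X 0 = 0 \<and> X 1 = n \<and> X 2 = k \<and> X 3 = 1 \<and> X 14 = 16 \<and> X 8 = n + 16 + u \<and>
    (\<forall>v<n. X (v + 16) = 0) \<and> (\<forall>v<u. X (n + 16 + v) = of_bool (bits ! v)) \<and> w = drop u bits"
  have "triple ?P (Block [Const 3 1]) (length [Const 3 1]) (?A 0)"
    by (intro triple_Block) auto
  \<comment> \<open>\<open>Suc n\<close> rounds: \<open>n\<close> ones and the separating zero that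
    ends the loop.\<close>
  moreover have "triple (?A 0) (Do_While (Block [Read 11, Add 1 1 11]) 11)
      ((Suc n - 0) * Suc (length [Read 11, Add 1 1 11])) ?B"
  proof (rule triple_Do_While[where I = ?A])
    fix v
    assume v: "v < Suc n"
    show "triple (?A v) (Block [Read 11, Add 1 1 11]) (length [Read 11, Add 1 1 11])
        (\<lambda>X w. if X 11 = 0 then ?B X w else Suc v < Suc n \<and> ?A (Suc v) X w)"
    proof (rule triple_Block)
      fix X w
      assume A: "?A v X w"
      show "case fold effect [Read 11, Add 1 1 11] (X, w) of (X', w') \<Rightarrow>
          if X' 11 = 0 then ?B X' w' else Suc v < Suc n \<and> ?A (Suc v) X' w'"
      proof (cases "n - v")
        case 0
        then show ?thesis
          using A v by simp
      next
        case (Suc m)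
        then have "m = n - Suc v" "v < n"
          by simp_all
        then show ?thesis
          using A Suc by simp
      qed
    qed simp
  qed simp
  moreover have "triple ?B (Block [Const 2 k, Const 14 16, Add 8 1 14])
      (length [Const 2 k, Const 14 16, Add 8 1 14]) (?C 0)"
    by (intro triple_Block) simp_all
  moreover have "triple (?C 0) (Do_While (Block [Read 11, Store 8 11, Add 8 8 3, Const 12 2, Sub 11 12 11]) 11)
      ((Suc (n * n) - 0) * Suc (length [Read 11, Store 8 11, Add 8 8 3, Const 12 2, Sub 11 12 11])) ?Q"
  proof (rule triple_Do_While[where I = ?C])
    fix u
    assume u: "u < Suc (n * n)"
    show "triple (?C u) (Block [Read 11, Store 8 11, Add 8 8 3, Const 12 2, Sub 11 12 11])
        (length [Read 11, Store 8 11, Add 8 8 3, Const 12 2, Sub 11 12 11])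
        (\<lambda>X w. if X 11 = 0 then ?Q X w else Suc u < Suc (n * n) \<and> ?C (Suc u) X w)"
    proof (rule triple_Block)
      fix X w
      assume C: "?C u X w"
      show "case fold effect [Read 11, Store 8 11, Add 8 8 3, Const 12 2, Sub 11 12 11] (X, w) of (X', w') \<Rightarrow>
          if X' 11 = 0 then ?Q X' w' else Suc u < Suc (n * n) \<and> ?C (Suc u) X' w'"
      proof (cases "u < n * n")
        case True
        then have "drop u bits = bits ! u # drop (Suc u) bits"
          by (simp add: Cons_nth_drop_Suc bits(1))
        moreover have "Suc u < n * n \<or> Suc u = n * n"
          using True by linarith
        ultimately show ?thesis
          using C by (simp add: less_Suc_eq)
      next
        case False
        then have "u = n * n"
          using u by simp
        \<comment> \<open>The last round stores the end marker 2 directly behind the matrix; every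
          matrix index stays below that cell.\<close>
        moreover have "i * n + j < n * n" if "i < n" "j < n" for i j
        proof -
          have "i * n + j < Suc i * n"
            using that(2) by simp
          also have "\<dots> \<le> n * n"
            using that(1) by (intro mult_le_mono1) simp
          finally show ?thesis .
        qed
        ultimately show ?thesis
          using C bits by (simp add: stored_def less_imp_neq)
      qed
    qed simp
  qed simp
  ultimately have "triple ?P (read_com k) (length [Const 3 1] + ((Suc n - 0) * Suc (length [Read 11, Add 1 1 11]) +
      (length [Const 2 k, Const 14 16, Add 8 1 14] +
       (Suc (n * n) - 0) * Suc (length [Read 11, Store 8 11, Add 8 8 3, Const 12 2, Sub 11 12 11])))) ?Q"
    unfolding read_com_def by (intro triple_Seq)
  then show ?thesis
    by (rule triple_consequence) (simp_all add: eval_nat_numeral)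
qed

lemma triple_greedy:
  assumes "0 < n" "0 < k" "length bits = n * n"
    "\<And>i j. i < n \<Longrightarrow> j < n \<Longrightarrow> bits ! (i * n + j) \<longleftrightarrow> (i, j) \<in> E"
  shows "triple (\<lambda>X w. X = (\<lambda>_. 0) \<and> w = replicate n True @ False # bits) (greedy_com k)
    (4 + Suc n * 3 + Suc (n * n) * 6 + (1 + n * (14 + k * (5 + n * (4 + n * 21)))))
    (\<lambda>X w. X 0 = snd (greedy E n k))"
proof -
  let ?\<sigma> = "\<lambda>s. fold (harvest E n k) [0..<s] (\<lambda>_. 0, 0)"
  let ?I = "\<lambda>s X w. stored E n k (fst (?\<sigma> s)) (snd (?\<sigma> s)) X"
  have "triple (\<lambda>X w. stored E n k (\<lambda>_. 0) 0 X) (For 4 1 harvest_com)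
      (1 + n * (11 + k * (5 + n * (4 + n * 21)) + 3)) (?I n)"
  proof (rule triple_For[where I = ?I])
    show "triple (\<lambda>X w. ?I s X w \<and> X 4 = s) harvest_com (11 + k * (5 + n * (4 + n * 21)))
        (\<lambda>X w. X 4 = s \<and> X 3 = 1 \<and> X 1 = n \<and> ?I (Suc s) (X(4 := Suc s, 11 := n - Suc s)) w)"
      if "s < n" for s
      by (rule triple_consequence[OF triple_harvest[OF assms(1,2) that, of E "?\<sigma> s"]])
        (simp_all, simp add: stored_def)
  qed (use assms(1) in simp_all)
  with triple_read[OF assms(3,4)]
  have "triple (\<lambda>X w. X = (\<lambda>_. 0) \<and> w = replicate n True @ False # bits) (greedy_com k)
    (4 + Suc n * 3 + Suc (n * n) * 6 + (1 + n * (11 + k * (5 + n * (4 + n * 21)) + 3))) (?I n)"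
    unfolding greedy_com_def by (rule triple_Seq)
  then show ?thesis
    by (rule triple_consequence) (simp_all add: stored_def greedy_def)
qed

section \<open>The approximation algorithm\<close>

lemma length_row_major: "length (concat (map (\<lambda>i. map (f i) [0..<n]) [0..<m])) = m * n"
  by (induction m) simp_all

lemma nth_row_major:
  assumes "i < m" "j < n"
  shows "concat (map (\<lambda>i. map (f i) [0..<n]) [0..<m]) ! (i * n + j) = f i j"
  using assms(1)
proof (induction m)
  case (Suc m)
  show ?case
  proof (cases "i = m")
    case True
    then show ?thesis
      using assms(2) by (simp add: nth_append length_row_major)
  next
    case False
    then have "i < m"
      using Suc.prems by simp
    have "i * n + j < Suc i * n"
      using assms(2) by simp
    also have "\<dots> \<le> m * n"
      using \<open>i < m\<close> by (intro mult_le_mono1) simp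
    finally show ?thesis
      using Suc.IH[OF \<open>i < m\<close>] by (simp add: nth_append length_row_major)
  qed
qed simp

lemma encode_graph_row_major:
  assumes "card (pverts G) = n"
  shows "encode_graph G =
    replicate n True @ False # concat (map (\<lambda>i. map (\<lambda>j. (i, j) \<in> parcs G) [0..<n]) [0..<n])"
  using assms by (simp add: encode_graph_def Let_def)

lemma polytime_greedy:
  assumes "0 < k"
  shows "polytime_computable connected_simple_graphs encode_graph
    (\<lambda>G. snd (greedy (parcs G) (card (pverts G)) k))"
proof -
  let ?X = "[:0, 1:] :: nat poly"
  \<comment> \<open>The bound of \<open>triple_greedy\<close> with both \<open>n\<close> and
    \<open>n * n\<close> replaced by the input length, which dominates each of them.\<close>
  define q where "q = 4 + (?X + 1) * 3 + (?X + 1) * 6 + (1 + ?X * (14 + [:k:] * (5 + ?X * (4 + ?X * 21))))"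
  show ?thesis
    unfolding polytime_computable_def
  proof (intro exI ballI)
    fix G
    assume "G \<in> connected_simple_graphs"
    then obtain n where G: "Digraph_Component.connected (with_proj G)" "pverts G = {0..<n}"
      by (auto simp: connected_simple_graphs_def)
    \<comment> \<open>Connectedness includes a nonempty vertex set; the loops test only after the
      body and rely on \<open>0 < n\<close>.\<close>
    have n: "0 < n" "card (pverts G) = n"
      using G by (auto simp: connected_def strongly_connected_def mk_symmetric_def)
    let ?bits = "concat (map (\<lambda>i. map (\<lambda>j. (i, j) \<in> parcs G) [0..<n]) [0..<n])"
    define l where "l = length (encode_graph G)"
    have l: "n \<le> l" "n * n \<le> l"
      by (simp_all add: l_def encode_graph_row_major[OF n(2)] length_row_major)
    have "4 + Suc n * 3 + Suc (n * n) * 6 + (1 + n * (14 + k * (5 + n * (4 + n * 21)))) \<le>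
        4 + Suc l * 3 + Suc l * 6 + (1 + l * (14 + k * (5 + l * (4 + l * 21))))"
      using l by (intro add_mono mult_le_mono Suc_le_mono[THEN iffD2] order_refl)
    also have "\<dots> = poly q l"
      by (simp add: q_def)
    finally show "outputs_within (code 0 (greedy_com k)) (encode_graph G) (poly q (length (encode_graph G)))
        (snd (greedy (parcs G) (card (pverts G)) k))"
      unfolding n(2) l_def encode_graph_row_major[OF n(2)]
      by (intro triple_outputs_within[OF triple_greedy[OF n(1) assms length_row_major]])
        (simp_all add: nth_row_major)
  qed
qed

theorem theorem1p4:
  fixes k :: nat
  assumes "k \<ge> 2"
  shows "\<exists>A :: nat pair_pre_digraph \<Rightarrow> nat.
           polytime_computable connected_simple_graphs encode_graph A \<and>
           (\<forall>G \<in> connected_simple_graphs.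
              card (pverts G) - component_independence_number (k - 1) (with_proj G) \<le> A G \<and>
              A G \<le> k * (card (pverts G) - component_independence_number (k - 1) (with_proj G)))"
proof (intro exI conjI ballI)
  have k: "0 < k"
    using assms by simp
  \<comment> \<open>This goal instantiates the schematic witness for \<open>A\<close>.\<close>
  show "polytime_computable connected_simple_graphs encode_graph
      (\<lambda>G. snd (greedy (parcs G) (card (pverts G)) k))"
    using k by (rule polytime_greedy)
  fix G
  assume "G \<in> connected_simple_graphs"
  then obtain n where G: "pair_graph G" "pverts G = {0..<n}"
    by (auto simp: connected_simple_graphs_def)
  then have n: "card (pverts G) = n"
    by simp
  have "block_labelling (parcs G) n k n (fst (greedy (parcs G) n k), snd (greedy (parcs G) n k))"
    using block_labelling_greedy[OF k] by simp
  from greedy_approximation[OF G k this]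
  show "card (pverts G) - component_independence_number (k - 1) (with_proj G)
      \<le> snd (greedy (parcs G) (card (pverts G)) k)"
    and "snd (greedy (parcs G) (card (pverts G)) k)
      \<le> k * (card (pverts G) - component_independence_number (k - 1) (with_proj G))"
    unfolding n by blast+
qed

end
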